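(* Let $p,q\geq 1$ be integers. Then every left-invariant pseudo-Riemannian metric of signature $(p,q)$ on the Lie group $G_{\mathbb{R}\mathrm{H}^{p+q}}$ has constant sectional curvature. Furthermore, for every real number $c$ there exists a left-invariant pseudo-Riemannian metric of signature $(p,q)$ on $G_{\mathbb{R}\mathrm{H}^{p+q}}$ whose constant sectional curvature is $c$.
   Context: For a positive integer $n$, $G_{\mathbb{R}\mathrm{H}^n}$ is the connected and simply connected Lie group whose Lie algebra $\mathfrak{g}_{\mathbb{R}\mathrm{H}^n}$ has a basis $\{e_1,\ldots,e_n\}$ whose only nonzero brackets (up to skew-symmetry) are $[e_1,e_j]=e_j$ for $j\in\{2,\ldots,n\}$. Left-invariant pseudo-Riemannian metrics of signature $(p,q)$ on $G$ correspond one-to-one to inner products (nondegenerate symmetric bilinear forms) $\langle\cdot,\cdot\rangle$ of signature $(p,q)$ ($p$ positive, $q$ negative directions) on the Lie algebra $\mathfrak{g}$. In these terms the Levi-Civita connection is $\nabla_XY=\tfrac12[X,Y]+U(X,Y)$ for $X,Y\in\mathfrak{g}$, where $U$ is the symmetric bilinear map defined by $2\langle U(X,Y),Z\rangle=\langle[Z,X],Y\rangle+\langle X,[Z,Y]\rangle$ for all $Z\in\mathfrak{g}$; the curvature tensor is $R(X,Y)=[\nabla_X,\nabla_Y]-\nabla_{[X,Y]}$; and the sectional curvature of a nondegenerate plane spanned by $X,Y$ is $K=\dfrac{\langle R(X,Y)Y,X\rangle}{\langle X,X\rangle\langle Y,Y\rangle-\langle X,Y\rangle^2}$. The metric has constant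 sectional curvature $c$ if $K=c$ for every nondegenerate plane in $\mathfrak{g}$. *)

theory Defs
  imports "HOL-Analysis.Analysis"
begin

section \<open>The Lie group of real hyperbolic space\<close>

text \<open>
  For \<open>n = CARD('m) + 1\<close>, the connected and simply connected Lie group with Lie algebra
  \<open>[e\<^sub>1, e\<^sub>j] = e\<^sub>j\<close> is realised as the semidirect product of \<open>\<real>\<close> and \<open>\<real>\<^sup>n\<^sup>-\<^sup>1\<close>, where \<open>s\<close> acts by
  multiplication with \<open>exp s\<close>. The underlying manifold is the vector space \<open>\<real> \<times> \<real>\<^sup>n\<^sup>-\<^sup>1\<close> itself,
  so every tangent space is identified with that vector space; the neutral element is \<open>0\<close>.
\<close>

type_synonym 'm rh = "real \<times> (real ^ 'm)"

definition rh_mult :: "'m::finite rh \<Rightarrow> 'm rh \<Rightarrow> 'm rh" where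
  "rh_mult a b = (fst a + fst b, snd a + exp (fst a) *\<^sub>R snd b)"

definition rh_inverse :: "'m::finite rh \<Rightarrow> 'm rh" where
  "rh_inverse a = (- fst a, - (exp (- fst a) *\<^sub>R snd a))"

definition d_left :: "'m::finite rh \<Rightarrow> 'm rh \<Rightarrow> 'm rh \<Rightarrow> 'm rh" where
  "d_left a x = frechet_derivative (rh_mult a) (at x)"

definition left_invariant_field :: "'m::finite rh \<Rightarrow> 'm rh \<Rightarrow> 'm rh" where
  "left_invariant_field X a = d_left a 0 X"

definition vector_field_bracket ::
  "('a::real_normed_vector \<Rightarrow> 'a) \<Rightarrow> ('a \<Rightarrow> 'a) \<Rightarrow> 'a \<Rightarrow> 'a" where
  "vector_field_bracket V W x =
     frechet_derivative W (at x) (V x) - frechet_derivative V (at x) (W x)"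

definition rh_bracket :: "'m::finite rh \<Rightarrow> 'm rh \<Rightarrow> 'm rh" where
  "rh_bracket X Y =
     vector_field_bracket (left_invariant_field X) (left_invariant_field Y) 0"


section \<open>Left-invariant metrics\<close>

definition nondegenerate_on :: "('a::real_vector \<Rightarrow> 'a \<Rightarrow> real) \<Rightarrow> 'a set \<Rightarrow> bool" where
  "nondegenerate_on g S \<longleftrightarrow> (\<forall>x\<in>S. (\<forall>y\<in>S. g x y = 0) \<longrightarrow> x = 0)"

definition inner_product_of_signature ::
  "nat \<Rightarrow> nat \<Rightarrow> ('a::real_vector \<Rightarrow> 'a \<Rightarrow> real) \<Rightarrow> bool" where
  "inner_product_of_signature p q g \<longleftrightarrow>
     bilinear g \<and> (\<forall>x y. g x y = g y x) \<and> nondegenerate_on g UNIV \<and>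
     (\<exists>B. finite B \<and> independent B \<and> span B = UNIV \<and>
          pairwise (\<lambda>x y. g x y = 0) B \<and>
          card {b \<in> B. g b b > 0} = p \<and> card {b \<in> B. g b b < 0} = q)"

text \<open>
  No smoothness in the base point is demanded: it follows from left invariance.
\<close>

definition left_invariant_metric ::
  "nat \<Rightarrow> nat \<Rightarrow> ('m::finite rh \<Rightarrow> 'm rh \<Rightarrow> 'm rh \<Rightarrow> real) \<Rightarrow> bool" where
  "left_invariant_metric p q h \<longleftrightarrow>
     (\<forall>x. inner_product_of_signature p q (h x)) \<and>
     (\<forall>a x u v. h (rh_mult a x) (d_left a x u) (d_left a x v) = h x u v)"


section \<open>Curvature of an inner product on a Lie algebra\<close>

text \<open>
  By left invariance, the Levi-Civita connection of a left-invariant metric maps pairs of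
  left-invariant fields to left-invariant fields, and the Koszul formula reduces to the
  algebraic expression below on the Lie algebra. The description in \<open>U_map\<close> is well defined for
  every inner product on a finite-dimensional Lie algebra, see \<open>U_map_characterization\<close>.
\<close>

context
  fixes br :: "'a::real_vector \<Rightarrow> 'a \<Rightarrow> 'a" and g :: "'a \<Rightarrow> 'a \<Rightarrow> real"
begin

definition U_map :: "'a \<Rightarrow> 'a \<Rightarrow> 'a" where
  "U_map X Y = (THE u. \<forall>Z. 2 * g u Z = g (br Z X) Y + g X (br Z Y))"

definition levi_civita :: "'a \<Rightarrow> 'a \<Rightarrow> 'a" where
  "levi_civita X Y = (1/2) *\<^sub>R br X Y + U_map X Y"

definition curvature :: "'a \<Rightarrow> 'a \<Rightarrow> 'a \<Rightarrow> 'a" where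
  "curvature X Y Z =
     levi_civita X (levi_civita Y Z) - levi_civita Y (levi_civita X Z)
       - levi_civita (br X Y) Z"

definition sectional_curvature :: "'a \<Rightarrow> 'a \<Rightarrow> real" where
  "sectional_curvature X Y = g (curvature X Y Y) X / (g X X * g Y Y - (g X Y)\<^sup>2)"

definition constant_sectional_curvature :: "real \<Rightarrow> bool" where
  "constant_sectional_curvature c \<longleftrightarrow>
     (\<forall>X Y. X \<noteq> Y \<and> independent {X, Y} \<and> nondegenerate_on g (span {X, Y})
        \<longrightarrow> sectional_curvature X Y = c)"

end

definition metric_constant_curvature ::
  "('m::finite rh \<Rightarrow> 'm rh \<Rightarrow> 'm rh \<Rightarrow> real) \<Rightarrow> real \<Rightarrow> bool" where
  "metric_constant_curvature h c \<longleftrightarrow> constant_sectional_curvature rh_bracket (h 0) c"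


section \<open>Adequacy of the definitions\<close>

lemma rh_group: "Groups.group (rh_mult :: 'm::finite rh \<Rightarrow> _) 0 rh_inverse"
proof
  show "rh_mult (rh_mult a b) c = rh_mult a (rh_mult b c)" for a b c :: "'m rh"
    by (simp add: rh_mult_def exp_add algebra_simps)
  show "rh_mult 0 a = a" for a :: "'m rh"
    by (simp add: rh_mult_def)
  show "rh_mult (rh_inverse a) a = 0" for a :: "'m rh"
    by (simp add: rh_mult_def rh_inverse_def zero_prod_def)
qed

lemma rh_simply_connected: "simply_connected (UNIV :: 'm::finite rh set)"
  by (simp add: convex_imp_simply_connected)

lemma d_left_eq: "d_left a x u = (fst u, exp (fst a) *\<^sub>R snd u)"
proof -
  have "(rh_mult a has_derivative (\<lambda>u. (fst u, exp (fst a) *\<^sub>R snd u))) (at x)"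
    unfolding rh_mult_def by (auto intro!: derivative_eq_intros)
  from frechet_derivative_at[OF this] show ?thesis
    by (simp add: d_left_def fun_eq_iff)
qed

lemma rh_bracket_eq:
  fixes X Y :: "'m::finite rh"
  shows "rh_bracket X Y = (0, fst X *\<^sub>R snd Y - fst Y *\<^sub>R snd X)"
proof -
  have "(left_invariant_field X has_derivative (\<lambda>u. (0, fst u *\<^sub>R snd X))) (at 0)"
    for X :: "'m rh"
    unfolding left_invariant_field_def d_left_eq
    by (auto intro!: derivative_eq_intros)
  then have "frechet_derivative (left_invariant_field X) (at 0) = (\<lambda>u. (0, fst u *\<^sub>R snd X))"
    for X :: "'m rh"
    by (metis frechet_derivative_at)
  then show ?thesis
    by (simp add: rh_bracket_def vector_field_bracket_def left_invariant_field_def d_left_eq)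
qed

lemma bilinear_rh_bracket: "bilinear rh_bracket"
  by (auto simp: bilinear_def rh_bracket_eq algebra_simps intro!: linearI)

lemma rh_Basis: "(Basis :: 'm::finite rh set) = insert (1, 0) (range (\<lambda>j. (0, axis j 1)))"
  by (auto simp: Basis_prod_def Basis_vec_def)

lemma rh_structure_constants:
  "rh_bracket (1, 0) (0, axis j 1) = (0, axis j 1)"
  "rh_bracket (0, axis i 1) (0, axis j 1) = 0"
  by (simp_all add: rh_bracket_eq zero_prod_def)

lemma U_map_characterization:
  assumes g: "inner_product_of_signature p q g" and br: "bilinear br"
  shows "2 * g (U_map br g X Y) Z = g (br Z X) Y + g X (br Z Y)"
proof -
  from g obtain B where g_bil: "bilinear g" and g_sym: "\<And>x y. g x y = g y x"
    and g_nd: "nondegenerate_on g UNIV" and B: "finite B" "span B = UNIV"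
      "pairwise (\<lambda>x y. g x y = 0) B"
    unfolding inner_product_of_signature_def by blast
  note lin = bilinear_ladd bilinear_lmul bilinear_radd bilinear_rmul bilinear_lzero bilinear_rzero
  define \<phi> where "\<phi> Z = (g (br Z X) Y + g X (br Z Y)) / 2" for Z
  have \<phi>: "linear \<phi>"
    by (rule linearI) (simp_all add: \<phi>_def lin[OF g_bil] lin[OF br] field_simps)
  have lin_g: "linear (g u)" for u
    using g_bil by (simp add: bilinear_def)
  have diag: "\<phi> b = 0" if "b \<in> B" "g b b = 0" for b
  proof -
    have "g b c = 0" if "c \<in> B" for c
      using that \<open>b \<in> B\<close> \<open>g b b = 0\<close> B(3) by (auto simp: pairwise_def)
    then have "g b y = 0" for y
      using linear_eq_on_span[OF lin_g linear_zero, of B b y] B(2) by simp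
    then have "b = 0"
      using g_nd by (auto simp: nondegenerate_on_def)
    then show ?thesis
      using \<phi> by (simp add: linear_0)
  qed
  define u where "u = (\<Sum>b\<in>B. (\<phi> b / g b b) *\<^sub>R b)"
  have "g u c = \<phi> c" if "c \<in> B" for c
  proof -
    have "linear (\<lambda>x. g x c)"
      using g_bil by (simp add: bilinear_def)
    then have "g u c = (\<Sum>b\<in>B. (\<phi> b / g b b) * g b c)"
      by (simp add: u_def linear_sum[of "\<lambda>x. g x c"] bilinear_lmul[OF g_bil])
    also have "\<dots> = (\<Sum>b\<in>B. if b = c then \<phi> c else 0)"
      using B(3) that diag by (intro sum.cong) (auto simp: pairwise_def)
    finally show ?thesis
      using that B(1) by simp
  qed
  then have ex: "g u Z = \<phi> Z" for Z
    using linear_eq_on_span[OF lin_g \<phi>, of B u Z] B(2) by simp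
  have "u' = u" if "\<forall>Z. 2 * g u' Z = g (br Z X) Y + g X (br Z Y)" for u'
  proof -
    have "g u' Z = g u Z" for Z
    proof -
      have "2 * g u' Z = 2 * \<phi> Z"
        using that by (simp add: \<phi>_def)
      then show ?thesis
        by (simp add: ex)
    qed
    then have "g (u' - u) Z = 0" for Z
      by (simp add: bilinear_lsub[OF g_bil])
    then have "u' - u = 0"
      using g_nd unfolding nondegenerate_on_def by blast
    then show ?thesis by simp
  qed
  then have "\<exists>!u. \<forall>Z. 2 * g u Z = g (br Z X) Y + g X (br Z Y)"
    by (intro ex1I[of _ u]) (simp_all add: ex, simp add: \<phi>_def)
  from theI'[OF this] show ?thesis
    by (simp add: U_map_def)
qed

end

theory Submission
  imports Defs
begin

text \<open>
  The bracket is \<open>[X, Y] = l X *\<^sub>R Y - l Y *\<^sub>R X\<close> for the linear form \<open>l = fst\<close>. If \<open>T\<close> is the vector dual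
  to \<open>l\<close>, the connection is \<open>\<nabla>\<^sub>X Y = \<langle>X, Y\<rangle> T - l Y *\<^sub>R X\<close>, and this gives
  \<open>R(X, Y) Z = - l T (\<langle>Y, Z\<rangle> X - \<langle>X, Z\<rangle> Y)\<close>: the curvature is the constant \<open>- l T = - \<langle>T, T\<rangle>\<close>.
  In an indefinite signature a nonzero vector can have any square norm, so every constant occurs.
\<close>

section \<open>Inner products of a given signature\<close>

text \<open>The preimages under \<open>f\<close> of an orthogonal basis for \<open>g\<close> are
  orthogonal for the new form and keep their squares, so the sign counts persist. This serves both
  translation of a metric and change of coordinates.\<close>

lemma inner_product_of_signature_pullback:
  fixes g :: "'a::euclidean_space \<Rightarrow> 'a \<Rightarrow> real"
    and f :: "'a \<Rightarrow> 'a"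
  assumes g: "inner_product_of_signature p q g" and f: "linear f" "inj f"
  shows "inner_product_of_signature p q (\<lambda>x y. g (f x) (f y))"
proof -
  from g obtain B where g_bil: "bilinear g" and g_sym: "\<And>x y. g x y = g y x"
    and g_nd: "\<And>x. (\<forall>y. g x y = 0) \<Longrightarrow> x = 0"
    and B: "finite B" "independent B" "span B = UNIV" "pairwise (\<lambda>x y. g x y = 0) B"
      "card {b \<in> B. g b b > 0} = p" "card {b \<in> B. g b b < 0} = q"
    unfolding inner_product_of_signature_def nondegenerate_on_def by blast
  obtain f' where f': "linear f'" "\<And>x. f' (f x) = x" "\<And>x. f (f' x) = x"
    using linear_injective_isomorphism[OF f refl] by blast
  have inj: "inj f'" and surj: "surj f'"
    using f' by (metis injI, metis surjI)
  have "{b \<in> f' ` B. P (g (f b) (f b))} = f' ` {b \<in> B. P (g b b)}" for P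
    by (auto simp: f'(3))
  then have card: "card {b \<in> f' ` B. P (g (f b) (f b))} = card {b \<in> B. P (g b b)}" for P
    using inj by (simp add: card_image inj_on_subset)
  note lin = bilinear_ladd bilinear_lmul bilinear_radd bilinear_rmul
  have "bilinear (\<lambda>x y. g (f x) (f y))"
    by (auto simp: bilinear_def linear_add[OF f(1)] linear_scale[OF f(1)] lin[OF g_bil]
        intro!: linearI)
  moreover have "nondegenerate_on (\<lambda>x y. g (f x) (f y)) UNIV"
    unfolding nondegenerate_on_def by (metis UNIV_I f'(2,3) g_nd f(1) f'(1) linear_0)
  moreover have "independent (f' ` B)"
    using linear_independent_injective_image[OF f'(1) B(2)] inj by (simp add: inj_on_subset)
  moreover have "span (f' ` B) = UNIV"
    using linear_span_image[OF f'(1)] B(3) surj by simp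
  moreover have "pairwise (\<lambda>x y. g (f x) (f y) = 0) (f' ` B)"
    using B(4) by (auto simp: pairwise_def f'(3))
  moreover have "card {b \<in> f' ` B. g (f b) (f b) > 0} = p" "card {b \<in> f' ` B. g (f b) (f b) < 0} = q"
    using B(5,6) card[of "\<lambda>t. t > 0"] card[of "\<lambda>t. t < 0"] by simp_all
  moreover have "finite (f' ` B)"
    using B(1) by simp
  moreover have "\<forall>x y. g (f x) (f y) = g (f y) (f x)"
    using g_sym by blast
  ultimately show ?thesis
    unfolding inner_product_of_signature_def by blast
qed

definition diagonal_form :: "'a::euclidean_space set \<Rightarrow> 'a \<Rightarrow> 'a \<Rightarrow> real" where
  "diagonal_form P x y = (\<Sum>b\<in>Basis. (if b \<in> P then 1 else - 1) * (x \<bullet> b) * (y \<bullet> b))"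

lemma diagonal_form_Basis:
  assumes "b \<in> Basis"
  shows "diagonal_form P b y = (if b \<in> P then y \<bullet> b else - (y \<bullet> b))"
proof -
  have "diagonal_form P b y = (\<Sum>b'\<in>Basis. if b' = b then (if b \<in> P then y \<bullet> b else - (y \<bullet> b)) else 0)"
    unfolding diagonal_form_def using assms by (intro sum.cong) (auto simp: inner_Basis)
  then show ?thesis
    using assms by simp
qed

lemma bilinear_diagonal_form: "bilinear (diagonal_form P)"
  by (auto simp: bilinear_def diagonal_form_def algebra_simps sum.distrib sum_distrib_left
      intro!: linearI)

lemma diagonal_form_signature:
  fixes P :: "'a::euclidean_space set"
  assumes "P \<subseteq> Basis" "card P = p" "DIM('a) = p + q"
  shows "inner_product_of_signature p q (diagonal_form P)"
proof -
  note simps = diagonal_form_Basis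
  have sym: "diagonal_form P x y = diagonal_form P y x" for x y
    by (simp add: diagonal_form_def mult_ac)
  have "x = 0" if "\<forall>y. diagonal_form P x y = 0" for x
  proof (rule euclidean_eqI)
    fix b :: 'a assume "b \<in> Basis"
    then show "x \<bullet> b = 0 \<bullet> b"
      using that simps[of b P x] by (simp add: sym[of x] split: if_splits)
  qed
  then have "nondegenerate_on (diagonal_form P) UNIV"
    by (simp add: nondegenerate_on_def)
  moreover have "{b \<in> Basis. diagonal_form P b b > 0} = P"
    "{b \<in> Basis. diagonal_form P b b < 0} = Basis - P"
    using assms(1) by (auto simp: simps split: if_splits)
  then have "card {b \<in> Basis. diagonal_form P b b > 0} = p"
    "card {b \<in> Basis. diagonal_form P b b < 0} = q"
    using assms by (auto simp: card_Diff_subset finite_subset)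
  moreover have "pairwise (\<lambda>x y. diagonal_form P x y = 0) Basis"
    by (auto simp: pairwise_def simps inner_Basis)
  ultimately show ?thesis
    unfolding inner_product_of_signature_def
    using bilinear_diagonal_form sym independent_Basis span_Basis finite_Basis by blast
qed

text \<open>Keeps the denominator of \<open>sectional_curvature\<close> away from the default value
  of division by zero.\<close>

lemma nondegenerate_plane_gram_nonzero:
  assumes g_bil: "bilinear g" and g_sym: "\<And>x y. g x y = g y x"
    and XY: "X \<noteq> Y" "independent {X, Y}" "nondegenerate_on g (span {X, Y})"
  shows "g X X * g Y Y - (g X Y)\<^sup>2 \<noteq> 0"
proof
  assume 0: "g X X * g Y Y - (g X Y)\<^sup>2 = 0"
  note lin = bilinear_ladd[OF g_bil] bilinear_lmul[OF g_bil] bilinear_radd[OF g_bil]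
    bilinear_rmul[OF g_bil] bilinear_lsub[OF g_bil] bilinear_rsub[OF g_bil]
  have span: "X \<in> span {X, Y}" "Y \<in> span {X, Y}"
    by (auto intro: span_base)
  have null: "V = 0" if V: "V \<in> span {X, Y}" "g V X = 0" "g V Y = 0" for V
  proof -
    have "g V Z = 0" if "Z \<in> span {X, Y}" for Z
      using linear_eq_on_span[of "g V" "\<lambda>_. 0" "{X, Y}" Z] g_bil V that
      by (auto simp: bilinear_def linear_zero)
    then show ?thesis
      using XY(3) V(1) unfolding nondegenerate_on_def by blast
  qed
  have nz: "X \<noteq> 0" and notin: "X \<notin> span {Y}"
    using XY(1,2) by (metis dependent_zero insertI1, simp add: independent_insert)
  \<comment> \<open>This vector is orthogonal to \<open>Y\<close> identically, and its product with
    \<open>X\<close> is the Gram determinant; so it lies in the radical of the plane.\<close>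
  have "g Y Y *\<^sub>R X - g X Y *\<^sub>R Y = 0"
    by (rule null) (use 0 span g_sym in \<open>auto simp: lin power2_eq_square mult_ac
      intro!: span_diff span_scale\<close>)
  have "g Y Y = 0"
  proof (rule ccontr)
    assume "g Y Y \<noteq> 0"
    then have "X = (g X Y / g Y Y) *\<^sub>R Y"
      using \<open>g Y Y *\<^sub>R X - g X Y *\<^sub>R Y = 0\<close>
      by (metis (no_types, lifting) divide_inverse_commute eq_iff_diff_eq_0 scaleR_one
          scaleR_scaleR left_inverse)
    then show False
      using notin span_scale[OF span_base[of Y "{Y}"]] by (metis singletonI)
  qed
  moreover from this 0 have "g X Y = 0"
    by simp
  ultimately have "Y = 0"
    using null[OF span(2)] g_sym by simp
  then show False
    using XY(2) dependent_zero[of "{X, Y}"] by simp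
qed

section \<open>Brackets given by a linear form\<close>

text \<open>Nondegeneracy lets the description in \<open>U_map\<close> be evaluated by exhibiting
  any solution.\<close>

lemma U_map_unique:
  assumes "inner_product_of_signature p q g" and "bilinear br"
    and "\<And>Z. 2 * g u Z = g (br Z X) Y + g X (br Z Y)"
  shows "U_map br g X Y = u"
proof -
  have bil: "bilinear g" and nd: "nondegenerate_on g UNIV"
    using assms(1) by (auto simp: inner_product_of_signature_def)
  have "2 * g (U_map br g X Y) Z = 2 * g u Z" for Z
    using U_map_characterization[OF assms(1,2)] assms(3) by simp
  then have "g (U_map br g X Y - u) Z = 0" for Z
    by (simp add: bilinear_lsub[OF bil])
  then have "U_map br g X Y - u = 0"
    using nd unfolding nondegenerate_on_def by blast
  then show ?thesis
    by simp
qed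

locale linear_form_bracket =
  fixes l :: "'a::real_vector \<Rightarrow> real" and g :: "'a \<Rightarrow> 'a \<Rightarrow> real" and p q :: nat
  assumes l: "linear l" and signature: "inner_product_of_signature p q g"
begin

definition br :: "'a \<Rightarrow> 'a \<Rightarrow> 'a" where
  "br X Y = l X *\<^sub>R Y - l Y *\<^sub>R X"

lemma g_bilinear: "bilinear g" and g_sym: "g x y = g y x"
  using signature by (auto simp: inner_product_of_signature_def)

lemmas lin = linear_add[OF l] linear_diff[OF l] linear_scale[OF l]
  bilinear_ladd[OF g_bilinear] bilinear_radd[OF g_bilinear] bilinear_lmul[OF g_bilinear]
  bilinear_rmul[OF g_bilinear] bilinear_lsub[OF g_bilinear] bilinear_rsub[OF g_bilinear]

lemma bilinear_br: "bilinear br"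
  by (auto simp: bilinear_def br_def lin algebra_simps intro!: linearI)

text \<open>
  For non-null \<open>X\<close> the defining property of \<open>U(X, X)\<close> reads \<open>\<langle>U(X, X) + l X *\<^sub>R X, Z\<rangle> = \<langle>X, X\<rangle> l Z\<close>.
\<close>

lemma dual_vector_exists:
  assumes "p \<ge> 1"
  obtains T where "\<And>Z. g T Z = l Z"
proof -
  obtain B where "card {b \<in> B. g b b > 0} = p"
    using signature unfolding inner_product_of_signature_def by blast
  with assms have "{b \<in> B. g b b > 0} \<noteq> {}"
    by (metis card.empty not_one_le_zero)
  then obtain X where X: "g X X > 0"
    by blast
  have "g ((1 / g X X) *\<^sub>R (U_map br g X X + l X *\<^sub>R X)) Z = l Z" for Z
    using X U_map_characterization[OF signature bilinear_br, of X X Z]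
    by (simp add: br_def lin g_sym[of Z] field_simps)
  then show ?thesis
    using that by blast
qed

context
  fixes T assumes T: "\<And>Z. g T Z = l Z"
begin

text \<open>The defining identity of \<open>U_map\<close> expands to
  \<open>2 * l Z * g X Y - l X * g Y Z - l Y * g X Z\<close>, and \<open>T\<close> turns
  \<open>l Z\<close> into a product with \<open>Z\<close>. Adding half the bracket cancels the
  multiples of \<open>Y\<close> and doubles those of \<open>X\<close>.\<close>

lemma levi_civita_eq: "levi_civita br g X Y = g X Y *\<^sub>R T - l Y *\<^sub>R X"
proof -
  have U: "U_map br g X Y = g X Y *\<^sub>R T - (1/2) *\<^sub>R (l X *\<^sub>R Y + l Y *\<^sub>R X)"
  proof (rule U_map_unique[OF signature bilinear_br])
    fix Z
    show "2 * g (g X Y *\<^sub>R T - (1/2) *\<^sub>R (l X *\<^sub>R Y + l Y *\<^sub>R X)) Z = g (br Z X) Y + g X (br Z Y)"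
      by (simp add: br_def lin T g_sym[of Z Y] algebra_simps)
  qed
  have "levi_civita br g X Y = g X Y *\<^sub>R T - ((l Y / 2) *\<^sub>R X + (l Y / 2) *\<^sub>R X)"
    unfolding levi_civita_def br_def U by (simp add: scaleR_diff_right scaleR_add_right)
  then show ?thesis
    by (simp flip: scaleR_add_left)
qed

text \<open>The terms along \<open>T\<close> and those with factor \<open>l Z\<close> in the
  commutator are exactly the derivative along \<open>br X Y\<close>. What survives is the part
  \<open>- l T *\<^sub>R X\<close> of the derivative of \<open>T\<close> along \<open>X\<close>, and
  likewise for \<open>Y\<close>.\<close>

lemma curvature_eq: "curvature br g X Y Z = - l T *\<^sub>R (g Y Z *\<^sub>R X - g X Z *\<^sub>R Y)"
  by (simp add: curvature_def levi_civita_eq br_def lin g_sym[of Y X] g_sym[of _ T] T algebra_simps)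

lemma constant_curvature: "constant_sectional_curvature br g (- l T)"
proof -
  have "sectional_curvature br g X Y = - l T"
    if "X \<noteq> Y" "independent {X, Y}" "nondegenerate_on g (span {X, Y})" for X Y
  proof -
    have "g (curvature br g X Y Y) X = - l T * (g X X * g Y Y - (g X Y)\<^sup>2)"
      by (simp add: curvature_eq lin bilinear_lneg[OF g_bilinear] g_sym[of Y X]
          power2_eq_square algebra_simps)
    then show ?thesis
      using nondegenerate_plane_gram_nonzero[OF g_bilinear g_sym that]
      by (simp add: sectional_curvature_def)
  qed
  then show ?thesis
    by (simp add: constant_sectional_curvature_def)
qed

end

end

lemma rh_bracket_linear_form:
  assumes "inner_product_of_signature p q (g :: 'm::finite rh \<Rightarrow> 'm rh \<Rightarrow> real)"
  shows "linear_form_bracket fst g p q"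
    and "(rh_bracket :: 'm rh \<Rightarrow> _) = linear_form_bracket.br fst"
proof -
  show *: "linear_form_bracket fst g p q"
    using assms by (simp add: linear_form_bracket_def linear_fst)
  show "(rh_bracket :: 'm rh \<Rightarrow> _) = linear_form_bracket.br fst"
    \<comment> \<open>The first components agree because
      \<open>fst X * fst Y - fst Y * fst X\<close> vanishes.\<close>
    by (auto simp: fun_eq_iff rh_bracket_eq linear_form_bracket.br_def[OF *] prod_eq_iff)
qed

section \<open>Left-invariant metrics with prescribed curvature\<close>

lemma left_invariant_extension:
  fixes g :: "'m::finite rh \<Rightarrow> 'm rh \<Rightarrow> real"
  assumes "inner_product_of_signature p q g"
  obtains h where "left_invariant_metric p q h" "h 0 = g"
proof
  \<comment> \<open>\<open>D x\<close> is the differential at \<open>x\<close> of left translation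
    by \<open>rh_inverse x\<close>: it brings tangent vectors back to the identity.\<close>
  define D where "D x u = (fst u, exp (- fst x) *\<^sub>R snd u)" for x u :: "'m rh"
  have D: "linear (D x)" "inj (D x)" for x
    by (auto simp: D_def algebra_simps inj_def prod_eq_iff intro!: linearI)
  have "D (rh_mult a x) (d_left a x u) = D x u" for a x u
    by (simp add: D_def d_left_eq rh_mult_def flip: exp_add)
  then show "left_invariant_metric p q (\<lambda>x u v. g (D x u) (D x v))"
    by (simp add: left_invariant_metric_def inner_product_of_signature_pullback[OF assms D])
  show "(\<lambda>u v. g (D 0 u) (D 0 v)) = g"
    by (simp add: D_def)
qed

text \<open>
  In the coordinates \<open>x = fst X\<close>, \<open>w = snd X $ j\<close>, the form sought is \<open>2 x w + c w\<^sup>2\<close> plus a diagonal form in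
  the remaining coordinates. With \<open>y = x + c w / 2\<close> the first part is
  \<open>2 y w = (y / 2 + w)\<^sup>2 - (y / 2 - w)\<^sup>2\<close>, which gives the map \<open>f\<close> to a diagonal form.
\<close>

lemma signature_form_with_dual_vector:
  fixes c :: real
  assumes "p \<ge> 1" "q \<ge> 1" "p + q = CARD('m::finite) + 1"
  obtains g :: "'m::finite rh \<Rightarrow> 'm rh \<Rightarrow> real" and T
  where "inner_product_of_signature p q g" "\<And>Z. g T Z = fst Z" "fst T = - c"
proof -
  fix j :: 'm
  define e1 e2 :: "'m rh" where "e1 = (1, 0)" and "e2 = (0, axis j 1)"
  have e: "e1 \<in> Basis" "e2 \<in> Basis" "e1 \<noteq> e2"
    by (auto simp: e1_def e2_def rh_Basis)
  have dim: "DIM('m rh) = p + q"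
    using assms(3) by simp
  have "card (Basis - {e1, e2}) = p + q - 2"
    using e dim by (simp add: card_Diff_subset)
  \<comment> \<open>One positive direction is reserved for \<open>e1\<close> and one negative for
    \<open>e2\<close>; the other \<open>p - 1\<close> positive ones must fit into the remaining
    basis.\<close>
  then have "p - 1 \<le> card (Basis - {e1, e2})"
    using assms(1,2) by linarith
  then obtain P' where P': "P' \<subseteq> Basis - {e1, e2}" "card P' = p - 1" "finite P'"
    by (rule obtain_subset_with_card_n)
  define P where "P = insert e1 P'"
  have P: "P \<subseteq> Basis" "card P = p" "e1 \<in> P" "e2 \<notin> P"
    using P' e assms(1) by (auto simp: P_def card_insert_if)
  define w where "w Z = snd Z $ j" for Z :: "'m rh"
  define y where "y Z = fst Z + c / 2 * w Z" for Z
  \<comment> \<open>The \<open>j\<close>-th coordinate \<open>w Z\<close> becomes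
    \<open>y Z / 2 - w Z\<close>; the other coordinates of \<open>snd Z\<close> are kept.\<close>
  define f where "f Z = ((y Z / 2 + w Z, snd Z + (y Z / 2 - 2 * w Z) *\<^sub>R axis j 1) :: 'm rh)" for Z
  have f: "linear f"
    by (auto simp: f_def y_def w_def algebra_simps add_divide_distrib intro!: linearI)
  have f_j: "snd (f Z) $ j = y Z / 2 - w Z" for Z
    by (simp add: f_def w_def)
  have "Z = 0" if "f Z = 0" for Z
  proof -
    have "y Z / 2 + w Z = 0" "y Z / 2 - w Z = 0"
      using that f_j[of Z] by (simp_all add: f_def prod_eq_iff)
    then have "y Z = 0" "w Z = 0"
      by auto
    then show ?thesis
      using that by (simp add: f_def y_def prod_eq_iff)
  qed
  then have "inj f"
    using f by (simp add: linear_injective_0)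
  \<comment> \<open>Polarising \<open>2 x w + c w^2\<close> gives
    \<open>x w' + w x' + c w w'\<close>, which equals \<open>x'\<close> at \<open>x = - c\<close>,
    \<open>w = 1\<close>.\<close>
  define T :: "'m rh" where "T = (- c, axis j 1)"
  have "f T = (1 - c / 4) *\<^sub>R e1 + (- 1 - c / 4) *\<^sub>R e2"
    by (simp add: f_def T_def y_def w_def e1_def e2_def vec_eq_iff algebra_simps)
  then have "diagonal_form P (f T) (f Z) = (1 - c / 4) * fst (f Z) + (1 + c / 4) * snd (f Z) $ j" for Z
    using P e
    by (simp add: bilinear_ladd[OF bilinear_diagonal_form] bilinear_lmul[OF bilinear_diagonal_form]
        diagonal_form_Basis)
      (simp add: e1_def e2_def inner_prod_def inner_axis algebra_simps)
  also have "\<dots> Z = fst Z" for Z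
    unfolding f_j by (simp add: f_def y_def field_simps)
  finally have "diagonal_form P (f T) (f Z) = fst Z" for Z .
  moreover have "inner_product_of_signature p q (\<lambda>u v. diagonal_form P (f u) (f v))"
    using inner_product_of_signature_pullback[OF diagonal_form_signature[OF P(1,2) dim] f \<open>inj f\<close>] .
  ultimately show ?thesis
    using that[of "\<lambda>u v. diagonal_form P (f u) (f v)" T] by (simp add: T_def)
qed

theorem corollary1p2:
  fixes p q :: nat
  assumes "p \<ge> 1" and "q \<ge> 1" and "p + q = CARD('m::finite) + 1"
  shows "(\<forall>h :: 'm rh \<Rightarrow> 'm rh \<Rightarrow> 'm rh \<Rightarrow> real. left_invariant_metric p q h
            \<longrightarrow> (\<exists>c. metric_constant_curvature h c))
       \<and> (\<forall>c. \<exists>h :: 'm rh \<Rightarrow> 'm rh \<Rightarrow> 'm rh \<Rightarrow> real.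
            left_invariant_metric p q h \<and> metric_constant_curvature h c)"
proof (intro conjI allI impI)
  fix h :: "'m rh \<Rightarrow> 'm rh \<Rightarrow> 'm rh \<Rightarrow> real"
  assume "left_invariant_metric p q h"
  then have "inner_product_of_signature p q (h 0)"
    unfolding left_invariant_metric_def by blast
  note lf = rh_bracket_linear_form[OF this]
  obtain T where "\<And>Z. h 0 T Z = fst Z"
    using linear_form_bracket.dual_vector_exists[OF lf(1) assms(1)] by blast
  from linear_form_bracket.constant_curvature[OF lf(1) this]
  show "\<exists>c. metric_constant_curvature h c"
    unfolding metric_constant_curvature_def lf(2) by blast
next
  fix c :: real
  \<comment> \<open>The curvature is \<open>- fst T\<close>, hence the sign in
    \<open>fst T = - c\<close>.\<close>
  obtain g :: "'m rh \<Rightarrow> 'm rh \<Rightarrow> real" and T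
    where g: "inner_product_of_signature p q g" and T: "\<And>Z. g T Z = fst Z" "fst T = - c"
    using signature_form_with_dual_vector[OF assms] by blast
  obtain h where h: "left_invariant_metric p q h" "h 0 = g"
    using left_invariant_extension[OF g] by blast
  note lf = rh_bracket_linear_form[OF g]
  have "metric_constant_curvature h c"
    using linear_form_bracket.constant_curvature[OF lf(1) T(1)] T(2)
    by (simp add: metric_constant_curvature_def lf(2) h(2))
  with h show "\<exists>h :: 'm rh \<Rightarrow> 'm rh \<Rightarrow> 'm rh \<Rightarrow> real.
      left_invariant_metric p q h \<and> metric_constant_curvature h c"
    by blast
qed

end
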